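(* Let $\mathcal{L}=\mathcal{L}(x,\dot x,\ddot x):\mathbb{R}^n\times\mathbb{R}^n\times\mathbb{R}^n\to\mathbb{R}$ be a $C^1$ Lagrangian not depending on $t$, and consider the problem of minimizing $\int_a^b \mathcal{L}(x(t),\dot x(t),\ddot x(t))\,dt$ over all $x(\cdot)\in W_2^2$ satisfying the boundary conditions $x(a)=x_a^0$, $x(b)=x_b^0$, $\dot x(a)=x_a^1$, $\dot x(b)=x_b^1$. Suppose that the hypotheses $(S_0),(S_1),\dots,(S_n)$ (stated in the context) hold and that $\frac{\partial\mathcal L}{\partial\ddot x}$ is superlinear in the sense that there exist constants $\alpha>0$ and $\beta>0$ such that $$\alpha|w|+\beta\le\left|\frac{\partial\mathcal{L}}{\partial\ddot x}(s,v,w)\right|\quad\text{for all }(s,v,w)\in\mathbb{R}^n\times\mathbb{R}^n\times\mathbb{R}^n .$$ Then the problem does not admit the Lavrentiev gap $W_2^2-W_2^\infty$: $$\inf_{x(\cdot)\in W_2^2}\int_a^b\mathcal L(x(t),\dot x(t),\ddot x(t))\,dt=\inf_{x(\cdot)\in W_2^\infty}\int_a^b\mathcal L(x(t),\dot x(t),\ddot x(t))\,dt,$$ where both infima are over functions in the indicated class satisfying the boundary conditions.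
   Context: Let $a<b$ be real, $n\ge1$. $W_2^2$ is the space of functions $x:[a,b]\to\mathbb{R}^n$ such that $x$ and $\dot x=x'$ are absolutely continuous and $\ddot x=x''\in L^2([a,b])$; $W_2^\infty\subset W_2^2$ is the subspace of those $x$ with $\ddot x$ essentially bounded on $[a,b]$. The vectors $x_a^0,x_b^0,x_a^1,x_b^1\in\mathbb{R}^n$ are given, and a function $x(\cdot)\in W_2^2$ satisfying the boundary conditions is called admissible. The arguments of a Lagrangian are denoted $(t,x,\dot x,\ddot x)$ (an autonomous Lagrangian is regarded as a function of these arguments that is constant in $t$), and $\partial\mathcal L/\partial x$, $\partial\mathcal L/\partial\dot x$, $\partial\mathcal L/\partial\ddot x$ are the gradients with respect to the corresponding $\mathbb{R}^n$-arguments, with components $\partial\mathcal L/\partial x_i$, $\partial\mathcal L/\partial\dot x_i$, $\partial\mathcal L/\partial\ddot x_i$. $|\cdot|$ is the Euclidean norm. In the following hypotheses, $x(\cdot)$ stands for the admissible functions of the problem. $(S_0)$: there exist a continuous function $S:\mathbb{R}^{1+3n}\to[0,\infty)$ and $\delta>0$ such that $t\mapsto S(t,x(t),x'(t),x''(t))$ is in $L^2([a,b])$ and $\left|\frac{\partial\mathcal L}{\partial t}(\tau,x(t),x'(t),x''(t))\right|\le S(t,x(t),x'(t),x''(t))$ for all $t\in[a,b]$ and $|\tau-t|<\delta$. (This holds trivially when $\mathcal L$ does not depend on $t$.) $(S_i)$, $i=1,\dots,n$: there exist a continuous function $G:\mathbb{R}^{1+3n}\to[0,\infty)$ and $\delta>0$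 such that $t\mapsto G(t,x(t),x'(t),x''(t))$ is in $L^2([a,b])$ and, for all $t\in[a,b]$, $\left|\frac{\partial\mathcal L}{\partial x_i}(t,y,x'(t),x''(t))\right|\le G(t,x(t),x'(t),x''(t))$ for all $y\in\mathbb{R}^n$ with $y_j=x_j(t)$ for $j\ne i$ and $|y_i-x_i(t)|\le\delta$; $\left|\frac{\partial\mathcal L}{\partial\dot x_i}(t,x(t),y,x''(t))\right|\le G(t,x(t),x'(t),x''(t))$ for all $y\in\mathbb{R}^n$ with $y_j=x'_j(t)$ for $j\ne i$ and $|y_i-x'_i(t)|\le\delta$; $\left|\frac{\partial\mathcal L}{\partial\ddot x_i}(t,x(t),x'(t),y)\right|\le G(t,x(t),x'(t),x''(t))$ for all $y\in\mathbb{R}^n$ with $y_j=x''_j(t)$ for $j\ne i$ and $|y_i-x''_i(t)|\le\delta$. Where $x''(t)$ occurs, "for all $t$" refers to those $t$ at which $x''(t)$ exists (almost all $t$). *)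

theory Defs
  imports "HOL-Analysis.Analysis"
begin

section \<open>Derivatives on a compact interval and the classes of functions\<close>

text \<open>Functions on \<open>[a,b]\<close> are total functions on the reals, but every notion below depends on
  their values on \<open>[a,b]\<close> only. In particular derivatives are taken within \<open>[a,b]\<close>, so they are
  one-sided at the end points. Where no derivative exists, the values of \<open>D1\<close> and \<open>D2\<close> carry no
  information; membership in \<open>W22\<close> makes \<open>D1 a b x\<close> meaningful at every point of \<open>[a,b]\<close> and
  \<open>D2 a b x\<close> almost everywhere.\<close>

definition D1 :: "real \<Rightarrow> real \<Rightarrow> (real \<Rightarrow> 'a::real_normed_vector) \<Rightarrow> real \<Rightarrow> 'a" where
  "D1 a b x t = vector_derivative x (at t within {a..b})"

definition D2 :: "real \<Rightarrow> real \<Rightarrow> (real \<Rightarrow> 'a::real_normed_vector) \<Rightarrow> real \<Rightarrow> 'a" where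
  "D2 a b x = D1 a b (D1 a b x)"

text \<open>Absolute continuity. A pair \<open>(u,v)\<close> stands for the interval \<open>[u,v]\<close>; the intervals of a
  family may share end points.\<close>

definition abs_cont_on :: "real \<Rightarrow> real \<Rightarrow> (real \<Rightarrow> 'a::real_normed_vector) \<Rightarrow> bool" where
  "abs_cont_on a b f \<longleftrightarrow>
     (\<forall>\<epsilon>>0. \<exists>\<delta>>0. \<forall>F :: (real \<times> real) set.
        finite F \<and> (\<forall>(u, v)\<in>F. a \<le> u \<and> u \<le> v \<and> v \<le> b) \<and>
        pairwise (\<lambda>p q. {fst p<..<snd p} \<inter> {fst q<..<snd q} = {}) F \<and>
        (\<Sum>(u, v)\<in>F. v - u) < \<delta>
        \<longrightarrow> (\<Sum>(u, v)\<in>F. norm (f v - f u)) < \<epsilon>)"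

definition L2_on :: "real \<Rightarrow> real \<Rightarrow> (real \<Rightarrow> 'a::real_normed_vector) \<Rightarrow> bool" where
  "L2_on a b f \<longleftrightarrow>
     f \<in> borel_measurable (lebesgue_on {a..b}) \<and>
     integrable (lebesgue_on {a..b}) (\<lambda>t. (norm (f t))\<^sup>2)"

definition W22 :: "real \<Rightarrow> real \<Rightarrow> (real \<Rightarrow> 'a::real_normed_vector) set" where
  "W22 a b = {x. abs_cont_on a b x \<and>
                 (\<forall>t\<in>{a..b}. x differentiable (at t within {a..b})) \<and>
                 abs_cont_on a b (D1 a b x) \<and>
                 L2_on a b (D2 a b x)}"

definition W2inf :: "real \<Rightarrow> real \<Rightarrow> (real \<Rightarrow> 'a::real_normed_vector) set" where
  "W2inf a b = {x \<in> W22 a b. \<exists>C. AE t in lebesgue_on {a..b}. norm (D2 a b x t) \<le> C}"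

definition boundary_conditions ::
  "real \<Rightarrow> real \<Rightarrow> 'a \<Rightarrow> 'a \<Rightarrow> 'a \<Rightarrow> 'a \<Rightarrow> (real \<Rightarrow> 'a::real_normed_vector) set" where
  "boundary_conditions a b xa0 xb0 xa1 xb1 =
     {x. x a = xa0 \<and> x b = xb0 \<and> D1 a b x a = xa1 \<and> D1 a b x b = xb1}"


section \<open>Lagrangians\<close>

text \<open>The gradient; specified only where \<open>f\<close> is differentiable.\<close>

definition gradient :: "('a::real_inner \<Rightarrow> real) \<Rightarrow> 'a \<Rightarrow> 'a" where
  "gradient f z = (THE D. GDERIV f z :> D)"

lemma gradient_eq:
  assumes "GDERIV f z :> D"
  shows "gradient f z = D"
  unfolding gradient_def
proof (rule the_equality)
  fix D' assume "GDERIV f z :> D'"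
  then have "(\<lambda>h. inner h D') = (\<lambda>h. inner h D)"
    using assms unfolding gderiv_def by (rule has_derivative_unique)
  then have "inner (D' - D) D' = inner (D' - D) D"
    by (rule fun_cong)
  then have "inner (D' - D) (D' - D) = 0"
    by (simp add: inner_diff_right)
  then show "D' = D" by simp
qed (rule assms)

definition C1_function :: "('a::real_inner \<Rightarrow> real) \<Rightarrow> bool" where
  "C1_function f \<longleftrightarrow> (\<exists>D. (\<forall>z. GDERIV f z :> D z) \<and> continuous_on UNIV D)"

definition autonomous :: "('a \<times> 'a \<times> 'a \<Rightarrow> real) \<Rightarrow> real \<times> 'a \<times> 'a \<times> 'a \<Rightarrow> real" where
  "autonomous L = (\<lambda>(t, s, v, w). L (s, v, w))"

definition jet :: "real \<Rightarrow> real \<Rightarrow> (real \<Rightarrow> 'a::real_normed_vector) \<Rightarrow> real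
    \<Rightarrow> real \<times> 'a \<times> 'a \<times> 'a" where
  "jet a b x t = (t, x t, D1 a b x t, D2 a b x t)"

text \<open>The Lebesgue integral of the Lagrangian along \<open>x\<close>, as the integral of the positive part minus
  the integral of the negative part. It is extended real valued, with the usual convention of
  minimization problems (and of type \<open>ereal\<close>) that \<open>\<infinity> - \<infinity> = \<infinity>\<close>.\<close>

definition action :: "real \<Rightarrow> real \<Rightarrow> (real \<times> 'a \<times> 'a \<times> 'a \<Rightarrow> real)
    \<Rightarrow> (real \<Rightarrow> 'a::real_normed_vector) \<Rightarrow> ereal" where
  "action a b \<L> x =
     enn2ereal (\<integral>\<^sup>+t. ennreal (\<L> (jet a b x t)) \<partial>lebesgue_on {a..b}) -
     enn2ereal (\<integral>\<^sup>+t. ennreal (- \<L> (jet a b x t)) \<partial>lebesgue_on {a..b})"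


section \<open>The hypotheses on the Lagrangian along a function\<close>

text \<open>The points of \<open>[a,b]\<close> at which the second derivative exists.\<close>

definition D2_points :: "real \<Rightarrow> real \<Rightarrow> (real \<Rightarrow> 'a::real_normed_vector) \<Rightarrow> real set" where
  "D2_points a b x = {t \<in> {a..b}. D1 a b x differentiable (at t within {a..b})}"

definition hyp_S0 :: "real \<Rightarrow> real \<Rightarrow> (real \<times> 'a \<times> 'a \<times> 'a \<Rightarrow> real)
    \<Rightarrow> (real \<Rightarrow> 'a::real_normed_vector) \<Rightarrow> bool" where
  "hyp_S0 a b \<L> x \<longleftrightarrow>
     (\<exists>(S :: real \<times> 'a \<times> 'a \<times> 'a \<Rightarrow> real) \<delta>.
        continuous_on UNIV S \<and> (\<forall>z. 0 \<le> S z) \<and> 0 < \<delta> \<and>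
        L2_on a b (\<lambda>t. S (jet a b x t)) \<and>
        (\<forall>t\<in>D2_points a b x. \<forall>\<tau>. \<bar>\<tau> - t\<bar> < \<delta> \<longrightarrow>
           \<bar>deriv (\<lambda>r. \<L> (r, x t, D1 a b x t, D2 a b x t)) \<tau>\<bar> \<le> S (jet a b x t)))"

text \<open>The points obtained from \<open>p\<close> by moving its \<open>i\<close>-th coordinate by at most \<open>\<delta>\<close>.\<close>

definition coord_nbhd :: "'n \<Rightarrow> real \<Rightarrow> real ^ 'n \<Rightarrow> (real ^ 'n) set" where
  "coord_nbhd i \<delta> p = {y. (\<forall>j. j \<noteq> i \<longrightarrow> y $ j = p $ j) \<and> \<bar>y $ i - p $ i\<bar> \<le> \<delta>}"

definition hyp_S :: "real \<Rightarrow> real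
    \<Rightarrow> (real \<times> (real ^ 'n::finite) \<times> (real ^ 'n) \<times> (real ^ 'n) \<Rightarrow> real)
    \<Rightarrow> 'n \<Rightarrow> (real \<Rightarrow> real ^ 'n) \<Rightarrow> bool" where
  "hyp_S a b \<L> i x \<longleftrightarrow>
     (\<exists>(G :: real \<times> (real ^ 'n) \<times> (real ^ 'n) \<times> (real ^ 'n) \<Rightarrow> real) \<delta>.
        continuous_on UNIV G \<and> (\<forall>z. 0 \<le> G z) \<and> 0 < \<delta> \<and>
        L2_on a b (\<lambda>t. G (jet a b x t)) \<and>
        (\<forall>t\<in>D2_points a b x.
           (\<forall>y\<in>coord_nbhd i \<delta> (x t).
              \<bar>gradient (\<lambda>s. \<L> (t, s, D1 a b x t, D2 a b x t)) y $ i\<bar> \<le> G (jet a b x t)) \<and>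
           (\<forall>y\<in>coord_nbhd i \<delta> (D1 a b x t).
              \<bar>gradient (\<lambda>v. \<L> (t, x t, v, D2 a b x t)) y $ i\<bar> \<le> G (jet a b x t)) \<and>
           (\<forall>y\<in>coord_nbhd i \<delta> (D2 a b x t).
              \<bar>gradient (\<lambda>w. \<L> (t, x t, D1 a b x t, w)) y $ i\<bar> \<le> G (jet a b x t))))"

end

theory Submission
  imports Defs
begin

text \<open>A function whose gradient has norm at least \<open>\<alpha> |w| + \<beta>\<close> has no critical points, and neither
  has its sum with \<open>\<alpha> |w|\<^sup>2 / 2\<close>. The minimum of that sum over a ball of radius \<open>K\<close> is therefore
  attained on the sphere, so \<open>L (s, v, \<cdot>)\<close> drops by \<open>\<alpha> K\<^sup>2 / 2\<close> on the ball. Following such steep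
  accelerations, selected anew after short time steps, during a time \<open>1 / K\<close> changes \<open>(x, x')\<close> by a
  bounded amount and contributes about \<open>- \<alpha> K / 2\<close> to the action; a cubic curve then leads to the
  end point at bounded cost. Hence both infima are \<open>- \<infinity>\<close>.\<close>

section \<open>Steep accelerations at a frozen state\<close>

lemma superlinear_gradient_drop:
  fixes f :: "'a::euclidean_space \<Rightarrow> real"
  assumes D: "\<And>w. GDERIV f w :> D w"
    and grad: "\<And>w. \<alpha> * norm w + \<beta> \<le> norm (D w)"
    and "0 < \<alpha>" "0 < \<beta>" "0 \<le> K"
  shows "\<exists>w. norm w = K \<and> f w \<le> f 0 - \<alpha> / 2 * K\<^sup>2"
proof -
  define g where "g w = f w + \<alpha> / 2 * (w \<bullet> w)" for w
  have gd: "(g has_derivative (\<lambda>h. h \<bullet> D w + \<alpha> * (w \<bullet> h))) (at w)" for w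
    unfolding g_def
    using D[of w] unfolding gderiv_def
    by (auto intro!: derivative_eq_intros simp: inner_commute algebra_simps)
  have "continuous_on (cball 0 K) g"
    using gd has_derivative_continuous
    by (metis continuous_at_imp_continuous_on)
  then obtain w where w: "w \<in> cball 0 K" and min: "\<And>y. y \<in> cball 0 K \<Longrightarrow> g w \<le> g y"
    using continuous_attains_inf[of "cball 0 K" g] \<open>0 \<le> K\<close> by auto
  have "norm w = K"
  proof (rule ccontr)
    assume "norm w \<noteq> K"
    then have "w \<in> ball 0 K" using w by auto
    then have "(\<lambda>h. h \<bullet> D w + \<alpha> * (w \<bullet> h)) = (\<lambda>h. 0)"
      using min by (intro differential_zero_maxmin[of w "ball 0 K" g, OF _ _ gd]) auto
    \<comment> \<open>The direction \<open>D w + \<alpha> *\<^sub>R w\<close>, the gradient of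
      \<open>g\<close> at \<open>w\<close>, turns the vanishing derivative into a vanishing squared
      norm.\<close>
    then have "(D w + \<alpha> *\<^sub>R w) \<bullet> D w + \<alpha> * (w \<bullet> (D w + \<alpha> *\<^sub>R w)) = 0"
      by (rule fun_cong)
    then have "(D w + \<alpha> *\<^sub>R w) \<bullet> (D w + \<alpha> *\<^sub>R w) = 0"
      by (simp add: inner_add inner_commute algebra_simps)
    then have "D w = - (\<alpha> *\<^sub>R w)"
      by (simp add: eq_neg_iff_add_eq_0)
    then have "norm (D w) = \<alpha> * norm w" using \<open>0 < \<alpha>\<close> by simp
    then show False using grad[of w] \<open>0 < \<beta>\<close> by simp
  qed
  moreover have "g w \<le> g 0" using min \<open>0 \<le> K\<close> by simp
  ultimately show ?thesis
    by (intro exI[of _ w]) (simp add: g_def dot_square_norm)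
qed

section \<open>Lipschitz estimates and absolute continuity\<close>

lemma Lipschitz_imp_abs_cont_on:
  assumes lip: "\<And>u v. a \<le> u \<Longrightarrow> u \<le> v \<Longrightarrow> v \<le> b \<Longrightarrow> norm (f v - f u) \<le> C * (v - u)"
  shows "abs_cont_on a b f"
  unfolding abs_cont_on_def
proof (intro allI impI)
  fix \<epsilon> :: real assume "0 < \<epsilon>"
  \<comment> \<open>The sign of \<open>C\<close> is unknown; \<open>C'\<close> is positive, so
    \<open>\<epsilon> / C'\<close> can serve as the modulus.\<close>
  define C' where "C' = max C 1"
  have "0 < C'" by (simp add: C'_def)
  show "\<exists>\<delta>>0. \<forall>F. finite F \<and> (\<forall>(u, v)\<in>F. a \<le> u \<and> u \<le> v \<and> v \<le> b) \<and>
        pairwise (\<lambda>p q. {fst p<..<snd p} \<inter> {fst q<..<snd q} = {}) F \<and>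
        (\<Sum>(u, v)\<in>F. v - u) < \<delta> \<longrightarrow> (\<Sum>(u, v)\<in>F. norm (f v - f u)) < \<epsilon>"
  proof (intro exI[of _ "\<epsilon> / C'"] conjI allI impI)
    show "0 < \<epsilon> / C'" using \<open>0 < \<epsilon>\<close> \<open>0 < C'\<close> by simp
    fix F :: "(real \<times> real) set"
    assume F: "finite F \<and> (\<forall>(u, v)\<in>F. a \<le> u \<and> u \<le> v \<and> v \<le> b) \<and>
        pairwise (\<lambda>p q. {fst p<..<snd p} \<inter> {fst q<..<snd q} = {}) F \<and>
        (\<Sum>(u, v)\<in>F. v - u) < \<epsilon> / C'"
    have "(\<Sum>(u, v)\<in>F. norm (f v - f u)) \<le> (\<Sum>(u, v)\<in>F. C' * (v - u))"
    proof (rule sum_mono, clarify)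
      fix u v assume "(u, v) \<in> F"
      then have uv: "a \<le> u" "u \<le> v" "v \<le> b" using F by auto
      have "C * (v - u) \<le> C' * (v - u)"
        using uv by (intro mult_right_mono) (auto simp: C'_def)
      then show "norm (f v - f u) \<le> C' * (v - u)" using lip[OF uv] by linarith
    qed
    also have "\<dots> = C' * (\<Sum>(u, v)\<in>F. v - u)"
      by (simp add: sum_distrib_left case_prod_unfold)
    also have "\<dots> < \<epsilon>"
      using F \<open>0 < C'\<close> by (simp add: less_divide_eq mult.commute)
    finally show "(\<Sum>(u, v)\<in>F. norm (f v - f u)) < \<epsilon>" .
  qed
qed

lemma Lipschitz_if_piecewise_bounded_derivative:
  fixes v :: "real \<Rightarrow> 'a::banach"
  assumes "finite S" and cont: "continuous_on {a..b} v"
    and d: "\<And>t. t \<in> {a<..<b} - S \<Longrightarrow> \<exists>w. (v has_vector_derivative w) (at t) \<and> norm w \<le> C"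
    and "0 \<le> C" and st: "a \<le> s" "s \<le> t" "t \<le> b"
  shows "norm (v t - v s) \<le> C * (t - s)"
proof -
  \<comment> \<open>The value 0 at the exceptional points makes the bound \<open>C\<close> hold
    everywhere.\<close>
  define w where "w r = (if r \<in> {a<..<b} - S then vector_derivative v (at r) else 0)" for r
  have w: "(v has_vector_derivative w r) (at r)" "norm (w r) \<le> C" if "r \<in> {a<..<b} - S" for r
    using d[OF that] vector_derivative_at[of v _ r] that by (auto simp: w_def)
  have "(w has_integral (v t - v s)) {s..t}"
    using assms(1) st w by (intro fundamental_theorem_of_calculus_interior_strong[of S])
      (auto intro: continuous_on_subset[OF cont])
  moreover have "norm (w r) \<le> C" for r using w(2) \<open>0 \<le> C\<close> by (auto simp: w_def)
  ultimately show ?thesis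
    using has_integral_bound[of C w "v t - v s" s t] st \<open>0 \<le> C\<close> by simp
qed

lemma D1_eq:
  assumes "a < b" "t \<in> {a..b}" "(x has_vector_derivative v) (at t within {a..b})"
  shows "D1 a b x t = v"
  using assms vector_derivative_within_cbox[of a b t x v] by (simp add: D1_def)

lemma AE_lebesgue_on_notin_finite:
  assumes "finite (S :: real set)"
  shows "AE t in lebesgue_on {a..b}. t \<notin> S"
  using assms
  by (intro AE_I'[of "S \<inter> {a..b}"]) (auto simp: null_sets_restrict_space
        intro!: negligible_finite simp flip: negligible_iff_null_sets)

section \<open>Curves with piecewise differentiable velocity\<close>

text \<open>The shape of a curve glued from arcs: \<open>v\<close> is its velocity up to the end
  points, and \<open>S\<close> collects the interior corners of \<open>v\<close>, where no
  acceleration has to exist.\<close>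

locale piecewise_C2_curve =
  fixes a b :: real and x v :: "real \<Rightarrow> 'a::euclidean_space" and S :: "real set" and C :: real
  assumes ab: "a < b" and fin: "finite S" and C: "0 \<le> C"
    and cont: "continuous_on {a..b} v"
    and der: "\<And>t. t \<in> {a..b} \<Longrightarrow> (x has_vector_derivative v t) (at t within {a..b})"
    and der2: "\<And>t. t \<in> {a<..<b} - S \<Longrightarrow> \<exists>w. (v has_vector_derivative w) (at t) \<and> norm w \<le> C"
begin

lemma D1_curve: "t \<in> {a..b} \<Longrightarrow> D1 a b x t = v t"
  using D1_eq[OF ab _ der] by simp

lemma D2_curve:
  assumes "t \<in> {a<..<b}" "(v has_vector_derivative w) (at t)"
  shows "D2 a b x t = w"
proof -
  have "(D1 a b x has_vector_derivative w) (at t)"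
    using assms D1_curve
    by (intro has_vector_derivative_transform_within_open[OF assms(2), of "{a<..<b}"]) auto
  then show ?thesis
    using assms ab by (auto simp: D2_def intro!: D1_eq has_vector_derivative_at_within)
qed

text \<open>Bounded acceleration makes \<open>v\<close> Lipschitz, and the bounded \<open>v\<close>
  makes \<open>x\<close> Lipschitz; both are therefore absolutely continuous.\<close>

lemma W2inf_curve: "x \<in> W2inf a b"
proof -
  let ?M = "lebesgue_on {a..b}"
  have lipv: "norm (v t - v s) \<le> C * (t - s)" if "a \<le> s" "s \<le> t" "t \<le> b" for s t
    using Lipschitz_if_piecewise_bounded_derivative[OF fin cont der2 C that] by simp
  obtain B where B: "\<And>t. t \<in> {a..b} \<Longrightarrow> norm (v t) \<le> B"
    using compact_imp_bounded[OF compact_continuous_image[OF cont compact_Icc]]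
    unfolding bounded_iff by blast
  have lipx: "norm (x t - x s) \<le> B * (t - s)" if "a \<le> s" "s \<le> t" "t \<le> b" for s t
  proof -
    have "(v has_integral (x t - x s)) {s..t}"
      using that by (intro fundamental_theorem_of_calculus)
        (auto intro!: has_vector_derivative_within_subset[OF der])
    moreover have "0 \<le> B" using order_trans[OF norm_ge_zero B[of a]] ab by simp
    ultimately show ?thesis
      using B that has_integral_bound[of B v "x t - x s" s t] by simp
  qed
  have D2: "(v has_vector_derivative D2 a b x t) (at t)" "norm (D2 a b x t) \<le> C"
    if "t \<in> {a<..<b} - S" for t
    using der2[OF that] D2_curve[of t] that by auto
  \<comment> \<open>The fundamental theorem of calculus is invoked for measurability: a gauge
    integrable function is Lebesgue measurable.\<close>
  have "(D2 a b x has_integral (v b - v a)) {a..b}"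
    using fin ab D2(1) cont
    by (intro fundamental_theorem_of_calculus_interior_strong[of S]) auto
  then have meas: "D2 a b x \<in> borel_measurable ?M"
    by (intro integrable_imp_measurable) blast
  have "finite (insert a (insert b S))" using fin by simp
  from AE_lebesgue_on_notin_finite[OF this, of a b] AE_space[of ?M]
  have bound: "AE t in ?M. norm (D2 a b x t) \<le> C"
    by eventually_elim (use D2(2) in auto)
  interpret finite_measure ?M by (rule finite_measure_lebesgue_on) simp
  have "integrable ?M (\<lambda>t. (norm (D2 a b x t))\<^sup>2)"
    using bound meas
    by (intro integrable_const_bound[of _ "C\<^sup>2"]) (auto intro: power_mono elim!: eventually_mono)
  moreover have "abs_cont_on a b (D1 a b x)"
    using D1_curve lipv by (intro Lipschitz_imp_abs_cont_on[of a b _ C]) auto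
  moreover have "x differentiable (at t within {a..b})" if "t \<in> {a..b}" for t
    using der[OF that] by (rule differentiableI_vector)
  ultimately show ?thesis
    unfolding W2inf_def W22_def L2_on_def
    using meas bound Lipschitz_imp_abs_cont_on[of a b x, OF lipx] by auto
qed

end

section \<open>An upper bound for the action\<close>

text \<open>The positive part costs at most \<open>P\<close> on all of \<open>[a,b]\<close>, and the
  negative part gains at least \<open>N\<close> on \<open>[a,c)\<close>. Since the former integral
  is finite, the estimate survives an infinite negative part.\<close>

lemma action_le:
  assumes "a \<le> c" "c \<le> b" "0 \<le> P"
    and pos: "AE t in lebesgue_on {a..b}. \<L> (jet a b x t) \<le> P"
    and neg: "AE t in lebesgue_on {a..b}. t < c \<longrightarrow> \<L> (jet a b x t) \<le> - N"
    and "0 \<le> N"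
  shows "action a b \<L> x \<le> ereal (P * (b - a) - N * (c - a))"
proof -
  let ?M = "lebesgue_on {a..b}"
  have "(\<integral>\<^sup>+t. ennreal (\<L> (jet a b x t)) \<partial>?M) \<le> (\<integral>\<^sup>+t. ennreal P \<partial>?M)"
    using pos by (intro nn_integral_mono_AE) (auto elim!: eventually_mono intro: ennreal_leI)
  also have "\<dots> = ennreal (P * (b - a))"
    using assms by (simp add: emeasure_restrict_space ennreal_mult)
  finally have p: "enn2ereal (\<integral>\<^sup>+t. ennreal (\<L> (jet a b x t)) \<partial>?M) \<le> ereal (P * (b - a))"
    using assms by (simp add: less_eq_ennreal.rep_eq)
  have "{a..<c} \<subseteq> {a..b}" using assms by auto
  then have "emeasure ?M {a..<c} = ennreal (c - a)"
    using assms by (simp add: emeasure_restrict_space)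
  then have "ennreal (N * (c - a)) = (\<integral>\<^sup>+t. ennreal N * indicator {a..<c} t \<partial>?M)"
    using assms \<open>{a..<c} \<subseteq> {a..b}\<close> by (subst nn_integral_cmult_indicator)
      (auto simp: sets_restrict_space_iff ennreal_mult)
  also have "\<dots> \<le> (\<integral>\<^sup>+t. ennreal (- \<L> (jet a b x t)) \<partial>?M)"
    using neg by (intro nn_integral_mono_AE)
      (auto elim!: eventually_mono intro: ennreal_leI simp: indicator_def)
  finally have n: "ereal (N * (c - a)) \<le> enn2ereal (\<integral>\<^sup>+t. ennreal (- \<L> (jet a b x t)) \<partial>?M)"
    using assms by (simp add: less_eq_ennreal.rep_eq)
  show ?thesis
    unfolding action_def using ereal_minus_mono[OF p n] by simp
qed

section \<open>The steep arc\<close>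

text \<open>An Euler polygon. The acceleration granted by \<open>sel\<close> may depend
  discontinuously on the state, so it is kept constant during short time steps; uniform continuity
  of \<open>L\<close> limits the resulting error to \<open>e\<close>. The position is recovered as
  \<open>s0\<close> plus the integral of the velocity. \<open>Q\<close> bounds the speeds, and
  \<open>R\<close> bounds positions and speeds.\<close>

lemma steep_velocity_exists:
  fixes L :: "'a::euclidean_space \<times> 'a \<times> 'a \<Rightarrow> real"
  assumes contL: "continuous_on UNIV L"
    and sel: "\<And>s v. norm s \<le> R \<Longrightarrow> norm v \<le> R \<Longrightarrow> \<exists>w. norm w \<le> K \<and> L (s, v, w) \<le> M"
    and "a < c" "0 < K" "0 < e"
    and Q: "norm v0 + K * (c - a) \<le> Q" and R: "norm s0 + Q * (c - a) \<le> R" "Q \<le> R"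
  shows "\<exists>v S. finite S \<and> continuous_on {a..c} v \<and> v a = v0 \<and>
           (\<forall>t\<in>{a..c}. norm (v t) \<le> Q) \<and>
           (\<forall>t\<in>{a<..<c} - S. \<exists>w. (v has_vector_derivative w) (at t) \<and> norm w \<le> K \<and>
              L (s0 + integral {a..t} v, v t, w) \<le> M + e)"
proof -
  \<comment> \<open>A compact set containing all states and accelerations of the polygon.\<close>
  define A where "A = cball (0::'a) R \<times> cball (0::'a) R \<times> cball (0::'a) K"
  have "uniformly_continuous_on A L"
    unfolding A_def
    by (intro compact_uniformly_continuous continuous_on_subset[OF contL])
      (auto intro!: compact_Times)
  then obtain d where "d > 0" and d: "\<And>p q. p \<in> A \<Longrightarrow> q \<in> A \<Longrightarrow> dist q p < d \<Longrightarrow> dist (L q) (L p) < e"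
    unfolding uniformly_continuous_on_def using \<open>0 < e\<close> by metis
  have "0 \<le> norm v0 + K * (c - a)" using assms by simp
  then have "0 \<le> Q" using Q by linarith
  \<comment> \<open>In a step of length \<open>h = (c - a) / N\<close> the velocity moves by at most
    \<open>K * h\<close> and the position by at most \<open>Q * h\<close>; this \<open>N\<close>
    makes their sum smaller than \<open>d\<close>.\<close>
  obtain N :: nat where N: "(c - a) * (K + Q + 1) / d < real N"
    using reals_Archimedean2 by blast
  have "0 < (c - a) * (K + Q + 1) / d" using assms \<open>0 \<le> Q\<close> \<open>d > 0\<close> by simp
  then have "0 < real N" using N by linarith
  define h where "h = (c - a) / N"
  have h: "0 < h" "h * (K + Q) < d"
  proof -
    show "0 < h" using assms \<open>0 < real N\<close> by (simp add: h_def)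
    have "h * (K + Q + 1) < d"
      using N \<open>0 < real N\<close> \<open>d > 0\<close> by (simp add: h_def field_simps)
    then show "h * (K + Q) < d" using \<open>0 < h\<close> by (simp add: distrib_left)
  qed
  \<comment> \<open>The speed bound is linear in \<open>t - a\<close> because this form, unlike the
    constant \<open>Q\<close>, passes from one step to the next.\<close>
  define good where "good r v S \<longleftrightarrow> finite S \<and> continuous_on {a..r} v \<and> v a = v0 \<and>
           (\<forall>t\<in>{a..r}. norm (v t) \<le> norm v0 + K * (t - a)) \<and>
           (\<forall>t\<in>{a<..<r} - S. \<exists>w. (v has_vector_derivative w) (at t) \<and> norm w \<le> K \<and>
              L (s0 + integral {a..t} v, v t, w) \<le> M + e)" for r and v :: "real \<Rightarrow> 'a" and S
  have le_Q: "norm v0 + K * (t - a) \<le> Q" if "t \<le> c" for t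
    using Q \<open>0 < K\<close> that mult_left_mono[of "t - a" "c - a" K] by linarith
  have pos_bound: "norm (s0 + integral {a..t} v) \<le> R"
    if "a \<le> t" "t \<le> c" "continuous_on {a..t} v" "\<And>r. r \<in> {a..t} \<Longrightarrow> norm (v r) \<le> Q" for t v
  proof -
    have "norm (integral {a..t} v) \<le> Q * (t - a)"
      using that by (intro integral_bound) auto
    also have "\<dots> \<le> Q * (c - a)" using that \<open>0 \<le> Q\<close> by (intro mult_left_mono) auto
    finally show ?thesis using R norm_triangle_ineq[of s0 "integral {a..t} v"] by linarith
  qed
  have "\<exists>v S. good (a + real j * h) v S" if "j \<le> N" for j
    using that
  proof (induction j)
    case 0
    show ?case by (intro exI[of _ "\<lambda>_. v0"] exI[of _ "{}"]) (auto simp: good_def)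
  next
    case (Suc j)
    define r where "r = a + real j * h"
    obtain v S where "good r v S" using Suc r_def by auto
    then have fin: "finite S" and cont: "continuous_on {a..r} v" and va: "v a = v0"
      and vb: "\<And>t. t \<in> {a..r} \<Longrightarrow> norm (v t) \<le> norm v0 + K * (t - a)"
      and der: "\<And>t. t \<in> {a<..<r} - S \<Longrightarrow> \<exists>w. (v has_vector_derivative w) (at t) \<and> norm w \<le> K \<and>
              L (s0 + integral {a..t} v, v t, w) \<le> M + e"
      unfolding good_def by auto
    have "a \<le> r" using h by (simp add: r_def)
    have "real (Suc j) * h \<le> real N * h" using Suc.prems h by (intro mult_right_mono) auto
    moreover have "real N * h = c - a" using \<open>0 < real N\<close> by (simp add: h_def)
    ultimately have rc: "r + h \<le> c" by (simp add: r_def distrib_right)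
    have vQ: "norm (v t) \<le> Q" if "t \<in> {a..r}" for t
      using vb[OF that] le_Q[of t] that rc h by auto
    \<comment> \<open>The state \<open>(s, v r)\<close> at the start of the new step determines the
      acceleration \<open>w\<close> used throughout it.\<close>
    define s where "s = s0 + integral {a..r} v"
    have sR: "norm s \<le> R" "norm (v r) \<le> R"
      using pos_bound[of r v] vQ[of r] vQ cont rc h \<open>a \<le> r\<close> R(2) order_trans[of "norm (v r)" Q R]
      by (auto simp: s_def)
    then obtain w where w: "norm w \<le> K" "L (s, v r, w) \<le> M" using sel by blast
    define v' where "v' t = (if t \<le> r then v t else v r + (t - r) *\<^sub>R w)" for t
    have cont': "continuous_on {a..r+h} v'"
      unfolding v'_def
    proof (rule continuous_on_cases_le)
      show "continuous_on {t \<in> {a..r + h}. t \<le> r} v"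
        by (rule continuous_on_subset[OF cont]) auto
    qed (auto intro!: continuous_intros)
    have vb': "norm (v' t) \<le> norm v0 + K * (t - a)" if "t \<in> {a..r+h}" for t
    proof (cases "t \<le> r")
      case False
      have "norm (v' t) \<le> norm (v r) + (t - r) * norm w"
        using False norm_triangle_ineq[of "v r" "(t - r) *\<^sub>R w"] by (simp add: v'_def)
      also have "\<dots> \<le> norm v0 + K * (r - a) + (t - r) * K"
        using False w vb[of r] \<open>a \<le> r\<close> by (intro add_mono mult_left_mono) auto
      finally show ?thesis by (simp add: algebra_simps)
    qed (use vb that in \<open>auto simp: v'_def\<close>)
    have v'Q: "norm (v' t) \<le> Q" if "t \<in> {a..r+h}" for t
      using vb'[OF that] le_Q[of t] that rc by auto
    have int': "integral {a..t} v' = integral {a..t} v" if "t \<le> r" for t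
      using that by (intro integral_cong) (auto simp: v'_def)
    have "\<exists>u. (v' has_vector_derivative u) (at t) \<and> norm u \<le> K \<and>
              L (s0 + integral {a..t} v', v' t, u) \<le> M + e" if t: "t \<in> {a<..<r+h} - insert r S" for t
    proof (cases "t < r")
      case True
      then obtain u where u: "(v has_vector_derivative u) (at t)" "norm u \<le> K"
          "L (s0 + integral {a..t} v, v t, u) \<le> M + e"
        using der[of t] t by auto
      have "(v' has_vector_derivative u) (at t)"
        using True by (intro has_vector_derivative_transform_within_open[OF u(1), of "{..<r}"])
          (auto simp: v'_def)
      then show ?thesis using u True int'[of t] by (auto simp: v'_def)
    next
      case False
      then have "r < t" using t by auto
      have "((\<lambda>t. v r + (t - r) *\<^sub>R w) has_vector_derivative w) (at t)"
        by (auto intro!: derivative_eq_intros)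
      then have dv': "(v' has_vector_derivative w) (at t)"
        using \<open>r < t\<close> by (rule_tac has_vector_derivative_transform_within_open[of _ _ _ "{r<..}"])
          (auto simp: v'_def)
      \<comment> \<open>Compare the current state \<open>(y, v' t)\<close> with the state for which
        \<open>w\<close> was chosen.\<close>
      define y where "y = s0 + integral {a..t} v'"
      have ct: "continuous_on {a..t} v'" using cont' t by (auto intro: continuous_on_subset)
      have yR: "norm y \<le> R"
        unfolding y_def using pos_bound[of t v'] v'Q ct t rc by auto
      have "integral {a..t} v' = integral {a..r} v + integral {r..t} v'"
        using Henstock_Kurzweil_Integration.integral_combine[where a=a and b=t and c=r and f=v'] int'[of r] \<open>a \<le> r\<close> \<open>r < t\<close>
          integrable_continuous_real[OF ct] by simp
      then have "norm (y - s) \<le> Q * (t - r)"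
        unfolding y_def s_def using \<open>a \<le> r\<close> \<open>r < t\<close> t v'Q
        by (auto intro!: integral_bound continuous_on_subset[OF ct])
      moreover have "norm (v' t - v r) \<le> K * (t - r)"
        using \<open>r < t\<close> w mult_left_mono[of "norm w" K "t - r"] by (simp add: v'_def mult.commute)
      moreover have "(K + Q) * (t - r) \<le> (K + Q) * h"
        using t \<open>0 < K\<close> \<open>0 \<le> Q\<close> by (intro mult_left_mono) auto
      ultimately have "norm (y - s) + norm (v' t - v r) < d"
        using h(2) by (simp add: algebra_simps)
      \<comment> \<open>The third components coincide, so only position and velocity
        contribute.\<close>
      moreover have "dist (y, v' t, w) (s, v r, w) \<le> norm (y - s) + norm (v' t - v r)"
        using sqrt_sum_squares_le_sum[of "norm (y - s)" "norm (v' t - v r)"]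
        by (simp add: dist_norm norm_Pair)
      ultimately have "dist (L (y, v' t, w)) (L (s, v r, w)) < e"
        using yR sR w v'Q[of t] R t by (intro d) (auto simp: A_def)
      then have "L (y, v' t, w) \<le> M + e" using w(2) by (simp add: dist_real_def)
      then show ?thesis using dv' w(1) by (auto simp: y_def)
    qed
    then have "good (r + h) v' (insert r S)"
      unfolding good_def using fin cont' vb' va \<open>a \<le> r\<close> by (auto simp: v'_def)
    moreover have "r + h = a + real (Suc j) * h" by (simp add: r_def algebra_simps)
    ultimately show ?case by auto
  qed
  from this[of N] obtain v S where "good c v S"
    using \<open>0 < real N\<close> by (auto simp: h_def)
  then show ?thesis
    unfolding good_def using le_Q by (intro exI[of _ v] exI[of _ S]) force
qed

section \<open>The cubic connecting arc\<close>

text \<open>With \<open>u = (t - c) / (b - c)\<close>, the profile \<open>6 * u * (1 - u)\<close>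
  vanishes at both ends and has mean value 1. Adding its multiple by \<open>e\<close> to the linear
  interpolation of \<open>v1\<close> and \<open>v2\<close> keeps the end velocities and shifts the
  mean velocity by \<open>e\<close>, so any displacement can be reached.\<close>

lemma hermite_velocity:
  fixes v1 v2 e :: "'a::euclidean_space"
  assumes "c < b"
  obtains g where "g c = v1" "g b = v2" "continuous_on {c..b} g"
    "(g has_integral (b - c) *\<^sub>R (((v1 + v2) /\<^sub>R 2) + e)) {c..b}"
    "\<And>t. t \<in> {c..b} \<Longrightarrow> norm (g t) \<le> 2 * norm v1 + norm v2 + 6 * norm e"
    "\<And>t. t \<in> {c..b} \<Longrightarrow> \<exists>w. (g has_vector_derivative w) (at t) \<and>
       norm w \<le> (norm v1 + norm v2 + 6 * norm e) / (b - c)"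
proof
  define T where "T = b - c"
  define g where "g t = v1 + ((t - c) / T) *\<^sub>R (v2 - v1) +
    (6 * ((t - c) / T) * (1 - (t - c) / T)) *\<^sub>R e" for t
  have T: "0 < T" using assms by (simp add: T_def)
  show "g c = v1" "g b = v2" "continuous_on {c..b} g"
    using T by (auto simp: g_def T_def intro!: continuous_intros)
  \<comment> \<open>The antiderivative of \<open>g\<close> that vanishes at
    \<open>c\<close>.\<close>
  define G where "G t = (t - c) *\<^sub>R v1 + ((t - c)\<^sup>2 / (2 * T)) *\<^sub>R (v2 - v1) +
      (3 * (t - c)\<^sup>2 / T - 2 * (t - c) ^ 3 / T\<^sup>2) *\<^sub>R e" for t
  have dG: "(G has_vector_derivative g t) (at t within {c..b})" for t
  proof -
    have "((\<lambda>t. (t - c)\<^sup>2 / (2 * T)) has_real_derivative (t - c) / T) (at t within {c..b})"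
      "((\<lambda>t. 3 * (t - c)\<^sup>2 / T - 2 * (t - c) ^ 3 / T\<^sup>2) has_real_derivative
        6 * ((t - c) / T) * (1 - (t - c) / T)) (at t within {c..b})"
      "((\<lambda>t. t - c) has_real_derivative 1) (at t within {c..b})"
      using T by (auto intro!: derivative_eq_intros simp: field_simps power2_eq_square)
    from this[THEN has_vector_derivative_scaleR, OF has_vector_derivative_const] show ?thesis
      unfolding G_def g_def by (auto intro!: has_vector_derivative_add)
  qed
  have "(g has_integral (G b - G c)) {c..b}"
    using dG assms by (intro fundamental_theorem_of_calculus) auto
  moreover have "G b - G c = T *\<^sub>R (((v1 + v2) /\<^sub>R 2) + e)"
  proof -
    have "G c = 0" by (simp add: G_def)
    moreover have "T\<^sup>2 / (2 * T) = T / 2" "3 * T\<^sup>2 / T - 2 * T ^ 3 / T\<^sup>2 = T"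
      using T by (simp_all add: power2_eq_square power3_eq_cube)
    then have "G b = T *\<^sub>R v1 + (T / 2) *\<^sub>R (v2 - v1) + T *\<^sub>R e"
      unfolding G_def T_def[symmetric] by simp
    moreover have "T *\<^sub>R v1 = (T / 2) *\<^sub>R v1 + (T / 2) *\<^sub>R v1"
      by (simp flip: scaleR_left_distrib)
    ultimately show ?thesis by (simp add: algebra_simps)
  qed
  ultimately show "(g has_integral (b - c) *\<^sub>R (((v1 + v2) /\<^sub>R 2) + e)) {c..b}"
    by (simp add: T_def)
  fix t assume t: "t \<in> {c..b}"
  define w where "w = (1 / T) *\<^sub>R (v2 - v1) + (6 / T * (1 - 2 * ((t - c) / T))) *\<^sub>R e"
  have "(g has_vector_derivative w) (at t)"
    unfolding g_def w_def using T
    by (auto intro!: derivative_eq_intros simp: field_simps)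
  moreover have "norm w \<le> (norm v1 + norm v2 + 6 * norm e) / T"
  proof -
    have "0 \<le> (t - c) / T" "(t - c) / T \<le> 1" using t T by (auto simp: T_def)
    \<comment> \<open>This factor comes from differentiating \<open>u * (1 - u)\<close>, where
      \<open>u = (t - c) / T\<close>.\<close>
    then have *: "\<bar>1 - 2 * ((t - c) / T)\<bar> \<le> 1" unfolding abs_le_iff by linarith
    have "norm w \<le> norm ((1 / T) *\<^sub>R (v2 - v1)) + norm ((6 / T * (1 - 2 * ((t - c) / T))) *\<^sub>R e)"
      unfolding w_def by (rule norm_triangle_ineq)
    also have "\<dots> = (1 / T) * norm (v2 - v1) + 6 / T * \<bar>1 - 2 * ((t - c) / T)\<bar> * norm e"
      using T unfolding norm_scaleR abs_mult by simp
    also have "\<dots> \<le> (1 / T) * (norm v1 + norm v2) + 6 / T * 1 * norm e"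
      using T * norm_triangle_ineq4[of v2 v1]
      by (intro add_mono mult_left_mono mult_right_mono) auto
    finally show ?thesis by (simp add: add_divide_distrib)
  qed
  ultimately show "\<exists>w. (g has_vector_derivative w) (at t) \<and>
      norm w \<le> (norm v1 + norm v2 + 6 * norm e) / (b - c)"
    unfolding T_def by blast
  show "norm (g t) \<le> 2 * norm v1 + norm v2 + 6 * norm e"
  proof -
    have *: "0 \<le> (t - c) / T" "(t - c) / T \<le> 1" using t T by (auto simp: T_def)
    have "norm (g t) \<le> norm v1 + norm (((t - c) / T) *\<^sub>R (v2 - v1)) +
        norm ((6 * ((t - c) / T) * (1 - (t - c) / T)) *\<^sub>R e)"
      unfolding g_def by (intro order_trans[OF norm_triangle_ineq] add_mono norm_triangle_ineq order_refl)
    also have "\<dots> = norm v1 + ((t - c) / T) * norm (v2 - v1) +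
        6 * (((t - c) / T) * (1 - (t - c) / T)) * norm e"
      using * by (simp only: norm_scaleR abs_mult abs_of_nonneg diff_ge_0_iff_ge abs_numeral mult.assoc)
    also have "\<dots> \<le> norm v1 + 1 * (norm v1 + norm v2) + 6 * 1 * norm e"
      using * norm_triangle_ineq4[of v2 v1] mult_nonneg_nonneg[of "(t - c) / T" "1 - (t - c) / T"]
      by (intro add_mono mult_mono mult_le_one) (auto simp del: times_divide_eq_left)
    finally show ?thesis by simp
  qed
qed

section \<open>Curves of arbitrarily negative action\<close>

lemma continuous_bounded_above_on_cballs:
  fixes L :: "'a::euclidean_space \<times> 'a \<times> 'a \<Rightarrow> real"
  assumes "continuous_on UNIV L"
  obtains C where "0 \<le> C"
    "\<And>s v w. norm s \<le> R \<Longrightarrow> norm v \<le> R' \<Longrightarrow> norm w \<le> R'' \<Longrightarrow> L (s, v, w) \<le> C"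
proof -
  have "compact (L ` (cball 0 R \<times> cball 0 R' \<times> cball 0 R''))"
    by (intro compact_continuous_image continuous_on_subset[OF assms] compact_Times) auto
  then obtain C where "\<forall>r \<in> L ` (cball 0 R \<times> cball 0 R' \<times> cball 0 R''). \<bar>r\<bar> \<le> C"
    using compact_imp_bounded bounded_real by metis
  then show ?thesis
    by (intro that[of "max C 0"]) (auto simp: abs_le_iff le_max_iff_disj)
qed

lemma GDERIV_partial3:
  assumes "GDERIV L (s, v, w) :> D"
  shows "GDERIV (\<lambda>y. L (s, v, y)) w :> snd (snd D)"
proof -
  have "((\<lambda>y. (s, v, y)) has_derivative (\<lambda>h. (0, 0, h))) (at w)"
    by (auto intro!: derivative_eq_intros)
  from has_derivative_compose[OF this, of L "\<lambda>h. inner h D"] assms show ?thesis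
    by (simp add: gderiv_def inner_prod_def)
qed

text \<open>The cost of the connecting arc must be bounded before \<open>K\<close> is chosen. This
  is possible because \<open>K * (c - a) = 1\<close> limits the change of velocity on the steep arc
  to 1, whatever \<open>K\<close> is, and because at least the time \<open>T0\<close> remains
  afterwards. Hence the gain, of order \<open>\<alpha> * K / 2\<close>, eventually wins.\<close>

lemma action_unbounded_below:
  fixes L :: "'a::euclidean_space \<times> 'a \<times> 'a \<Rightarrow> real"
  assumes "a < b" and C1: "C1_function L"
    and "0 < \<alpha>" "0 < \<beta>"
    and grad: "\<And>s v w. \<alpha> * norm w + \<beta> \<le> norm (gradient (\<lambda>y. L (s, v, y)) w)"
  shows "\<exists>x \<in> W2inf a b \<inter> boundary_conditions a b xa0 xb0 xa1 xb1.
           action a b (autonomous L) x \<le> ereal r"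
proof -
  obtain D where D: "\<And>z. GDERIV L z :> D z" using C1 unfolding C1_function_def by blast
  have contL: "continuous_on UNIV L"
    using D unfolding gderiv_def
    by (metis continuous_at_imp_continuous_on has_derivative_continuous)
  have drop: "\<exists>w. norm w = K \<and> L (s, v, w) \<le> L (s, v, 0) - \<alpha> / 2 * K\<^sup>2" if "0 \<le> K" for s v K
  proof (rule superlinear_gradient_drop)
    show *: "GDERIV (\<lambda>y. L (s, v, y)) w :> snd (snd (D (s, v, w)))" for w
      by (rule GDERIV_partial3[OF D])
    show "\<alpha> * norm w + \<beta> \<le> norm (snd (snd (D (s, v, w))))" for w
      using grad[of w s v] gradient_eq[OF *] by simp
  qed (use assms that in auto)

  \<comment> \<open>On the steep arc \<open>V\<close> bounds the speed and \<open>R\<close> both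
    position and speed; the last summand of \<open>R\<close> ensures \<open>V \<le> R\<close>.
    \<open>E\<close> bounds the correction \<open>e\<close> of the connecting arc and
    \<open>W\<close> its acceleration. \<open>V'\<close> and \<open>R'\<close> bound speed and
    position on the whole curve. None of them involves \<open>K\<close>.\<close>
  define T0 where "T0 = (b - a) / 2"
  define V where "V = norm xa1 + 1"
  define R where "R = norm xa0 + V * (b - a) + V"
  define E where "E = (norm xb0 + R) / T0 + V + norm xb1"
  define V' where "V' = 2 * V + norm xb1 + 6 * E"
  define R' where "R' = norm xa0 + V' * (b - a)"
  define W where "W = (V + norm xb1 + 6 * E) / T0"
  have "0 < T0" "0 < V" using \<open>a < b\<close> by (auto simp: T0_def V_def add_nonneg_pos)
  have "0 < R" unfolding R_def using \<open>0 < V\<close> \<open>a < b\<close> by (intro add_nonneg_pos add_nonneg_nonneg) auto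
  have "0 < E" unfolding E_def using \<open>0 < V\<close> \<open>0 < R\<close> \<open>0 < T0\<close>
    by (intro add_pos_nonneg add_nonneg_pos divide_nonneg_pos) auto
  have "V \<le> V'" unfolding V'_def using \<open>0 < V\<close> \<open>0 < E\<close> norm_ge_zero[of xb1] by linarith
  have "0 \<le> W" unfolding W_def using \<open>0 < V\<close> \<open>0 < E\<close> \<open>0 < T0\<close> by simp

  obtain C where C: "0 \<le> C"
    "\<And>s v w. norm s \<le> R' \<Longrightarrow> norm v \<le> V' \<Longrightarrow> norm w \<le> W \<Longrightarrow> L (s, v, w) \<le> C"
    using continuous_bounded_above_on_cballs[OF contL] by blast
  \<comment> \<open>The radius 0 restricts this bound to \<open>L (s, v, 0)\<close>, the value from
    which the drop is measured.\<close>
  obtain C0 where C0: "0 \<le> C0"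
    "\<And>s v w. norm s \<le> R \<Longrightarrow> norm v \<le> R \<Longrightarrow> norm w \<le> (0::real) \<Longrightarrow> L (s, v, w) \<le> C0"
    using continuous_bounded_above_on_cballs[OF contL] by blast
  \<comment> \<open>The gain required: the cost of the connecting arc, the loss
    \<open>C0 + 1\<close> on the steep arc, and the target \<open>r\<close>.\<close>
  define B where "B = C * (b - a) + C0 + 1 + \<bar>r\<bar>"
  have "0 \<le> C * (b - a)" using C \<open>a < b\<close> by simp
  then have "0 < B" using C0 by (simp add: B_def)
  \<comment> \<open>The summands yield in turn \<open>1 \<le> K\<close>, a steep arc no longer than
    \<open>T0\<close>, and \<open>B \<le> \<alpha> / 2 * K\<close>.\<close>
  define K where "K = 1 + 1 / T0 + 2 * B / \<alpha>"
  have "0 < 2 * B / \<alpha>" "0 < 1 / T0" using \<open>0 < B\<close> \<open>0 < \<alpha>\<close> \<open>0 < T0\<close> by simp_all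
  then have K: "1 \<le> K" "1 / T0 \<le> K" "2 * B / \<alpha> \<le> K" unfolding K_def by linarith+
  have KB: "B \<le> \<alpha> / 2 * K" using K(3) \<open>0 < \<alpha>\<close> by (simp add: field_simps)
  define c where "c = a + 1 / K"
  have "1 / K \<le> T0" using K \<open>0 < T0\<close> by (simp add: field_simps)
  then have c: "a < c" "c < b" "T0 \<le> b - c" "K * (c - a) = 1" "c - a \<le> b - a"
    using K(1) \<open>a < b\<close> by (auto simp: c_def T0_def)
  \<comment> \<open>The drop diminished by the starting value \<open>C0\<close> and by the
    discretization error, taken to be 1.\<close>
  define N where "N = \<alpha> / 2 * K\<^sup>2 - C0 - 1"
  have "B * 1 \<le> \<alpha> / 2 * K * K" using KB K \<open>0 < B\<close> by (intro mult_mono) auto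
  moreover have "C0 + 1 \<le> B" using \<open>0 \<le> C * (b - a)\<close> by (simp add: B_def)
  ultimately have "0 \<le> N" by (simp add: N_def power2_eq_square)

  have "\<exists>v S. finite S \<and> continuous_on {a..c} v \<and> v a = xa1 \<and>
           (\<forall>t\<in>{a..c}. norm (v t) \<le> V) \<and>
           (\<forall>t\<in>{a<..<c} - S. \<exists>w. (v has_vector_derivative w) (at t) \<and> norm w \<le> K \<and>
              L (xa0 + integral {a..t} v, v t, w) \<le> C0 - \<alpha> / 2 * K\<^sup>2 + 1)"
  proof (rule steep_velocity_exists[OF contL, where R = R])
    fix s v :: 'a assume "norm s \<le> R" "norm v \<le> R"
    then have "L (s, v, 0) \<le> C0" using C0 by simp
    then show "\<exists>w. norm w \<le> K \<and> L (s, v, w) \<le> C0 - \<alpha> / 2 * K\<^sup>2"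
      using drop[of K s v] K by force
  next
    have "V * (c - a) \<le> V * (b - a)" using c \<open>0 < V\<close> by (intro mult_left_mono) auto
    then show "norm xa0 + V * (c - a) \<le> R" using \<open>0 < V\<close> unfolding R_def by linarith
    show "V \<le> R" using \<open>0 < V\<close> \<open>a < b\<close> by (simp add: R_def)
  qed (use c K in \<open>auto simp: V_def\<close>)
  then obtain v1 S where fin: "finite S" and cont1: "continuous_on {a..c} v1" and v1a: "v1 a = xa1"
    and v1V: "\<And>t. t \<in> {a..c} \<Longrightarrow> norm (v1 t) \<le> V"
    and der1: "\<And>t. t \<in> {a<..<c} - S \<Longrightarrow> \<exists>w. (v1 has_vector_derivative w) (at t) \<and> norm w \<le> K \<and>
              L (xa0 + integral {a..t} v1, v1 t, w) \<le> - N"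
    unfolding N_def by (auto simp: algebra_simps)

  define s1 where "s1 = xa0 + integral {a..c} v1"
  have "norm (integral {a..c} v1) \<le> V * (c - a)" using cont1 v1V c by (intro integral_bound) auto
  also have "\<dots> \<le> V * (b - a)" using c \<open>0 < V\<close> by (intro mult_left_mono) auto
  finally have s1R: "norm s1 \<le> R"
    using norm_triangle_ineq[of xa0 "integral {a..c} v1"] \<open>0 < V\<close> by (simp add: s1_def R_def)
  \<comment> \<open>Chosen so that the mean velocity on \<open>[c,b]\<close> becomes
    \<open>(xb0 - s1) /\<^sub>R (b - c)\<close>.\<close>
  define e where "e = (xb0 - s1) /\<^sub>R (b - c) - (v1 c + xb1) /\<^sub>R 2"
  have v1c: "norm (v1 c) \<le> V" using v1V c by simp
  have eE: "norm e \<le> E"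
  proof -
    have "norm ((xb0 - s1) /\<^sub>R (b - c)) = norm (xb0 - s1) / (b - c)"
      using c(2) by (simp add: divide_inverse mult.commute)
    moreover have "norm (xb0 - s1) / (b - c) \<le> (norm xb0 + R) / T0"
      using norm_triangle_ineq4[of xb0 s1] s1R c(3) \<open>0 < T0\<close> \<open>0 < R\<close>
      by (intro frac_le) auto
    moreover have "norm ((v1 c + xb1) /\<^sub>R 2) \<le> V + norm xb1"
      using norm_triangle_ineq[of "v1 c" xb1] v1c unfolding norm_scaleR
      by simp (use \<open>0 < V\<close> norm_ge_zero[of xb1] in linarith)
    ultimately show ?thesis
      unfolding e_def E_def
      using norm_triangle_ineq4[of "(xb0 - s1) /\<^sub>R (b - c)" "(v1 c + xb1) /\<^sub>R 2"] by linarith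
  qed
  obtain g where g: "g c = v1 c" "g b = xb1" "continuous_on {c..b} g"
    "(g has_integral (b - c) *\<^sub>R (((v1 c + xb1) /\<^sub>R 2) + e)) {c..b}"
    "\<And>t. t \<in> {c..b} \<Longrightarrow> norm (g t) \<le> 2 * norm (v1 c) + norm xb1 + 6 * norm e"
    "\<And>t. t \<in> {c..b} \<Longrightarrow> \<exists>w. (g has_vector_derivative w) (at t) \<and>
       norm w \<le> (norm (v1 c) + norm xb1 + 6 * norm e) / (b - c)"
    using hermite_velocity[OF \<open>c < b\<close>, where ?v1.0 = "v1 c" and ?v2.0 = xb1 and e = e] by metis
  have gV: "norm (g t) \<le> V'" if "t \<in> {c..b}" for t
    using g(5)[OF that] v1c eE by (simp add: V'_def)
  have gW: "\<exists>w. (g has_vector_derivative w) (at t) \<and> norm w \<le> W" if "t \<in> {c..b}" for t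
  proof -
    have "(norm (v1 c) + norm xb1 + 6 * norm e) / (b - c) \<le> W"
      unfolding W_def using v1c eE c \<open>0 < T0\<close> \<open>0 < V\<close> \<open>0 < E\<close> by (intro frac_le) auto
    then show ?thesis using g(6)[OF that] by force
  qed

  \<comment> \<open>The two velocities agree at \<open>c\<close>, so \<open>v\<close> is continuous
    and its integral \<open>x\<close> is differentiable there as well; only the acceleration may
    jump.\<close>
  define v where "v t = (if t \<le> c then v1 t else g t)" for t
  define x where "x t = xa0 + integral {a..t} v" for t
  have contv: "continuous_on {a..b} v"
    unfolding v_def
  proof (rule continuous_on_cases_le)
    show "continuous_on {t \<in> {a..b}. t \<le> c} v1"
      by (rule continuous_on_subset[OF cont1]) auto
    show "continuous_on {t \<in> {a..b}. c \<le> t} g"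
      by (rule continuous_on_subset[OF g(3)]) auto
  qed (use g in auto)
  have vV: "norm (v t) \<le> V'" if "t \<in> {a..b}" for t
    using v1V[of t] gV[of t] that \<open>V \<le> V'\<close> by (auto simp: v_def)
  have xR: "norm (x t) \<le> R'" if "t \<in> {a..b}" for t
  proof -
    have "norm (integral {a..t} v) \<le> V' * (t - a)"
      using that vV by (intro integral_bound) (auto intro: continuous_on_subset[OF contv])
    also have "\<dots> \<le> V' * (b - a)" using that \<open>V \<le> V'\<close> \<open>0 < V\<close> by (intro mult_left_mono) auto
    finally show ?thesis
      using norm_triangle_ineq[of xa0 "integral {a..t} v"] by (simp add: x_def R'_def)
  qed
  have x1: "x t = xa0 + integral {a..t} v1" if "t \<le> c" for t
    using that by (auto simp: x_def v_def intro!: integral_cong)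
  have xb: "x b = xb0"
  proof -
    have "(v has_integral (b - c) *\<^sub>R ((v1 c + xb1) /\<^sub>R 2 + e)) {c..b}"
      using g(1) by (intro has_integral_eq[OF _ g(4)]) (auto simp: v_def)
    then have "integral {c..b} v = xb0 - s1"
      using c by (simp add: integral_unique e_def)
    moreover have "x b = x c + integral {c..b} v"
      using Henstock_Kurzweil_Integration.integral_combine[where a=a and b=b and c=c and f=v] c
        integrable_continuous_real[OF contv]
      by (simp add: x_def)
    ultimately show ?thesis using x1[of c] by (simp add: s1_def)
  qed
  have dv1: "\<exists>w. (v has_vector_derivative w) (at t) \<and> norm w \<le> K \<and> L (x t, v t, w) \<le> - N"
    if t: "t \<in> {a<..<c} - S" for t
  proof -
    obtain w where w: "(v1 has_vector_derivative w) (at t)" "norm w \<le> K"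
      "L (xa0 + integral {a..t} v1, v1 t, w) \<le> - N" using der1[OF t] by blast
    have "(v has_vector_derivative w) (at t)"
      using t by (intro has_vector_derivative_transform_within_open[OF w(1), of "{..<c}"])
        (auto simp: v_def)
    then show ?thesis using w t x1[of t] by (auto simp: v_def)
  qed
  have dv2: "\<exists>w. (v has_vector_derivative w) (at t) \<and> norm w \<le> W" if t: "t \<in> {c<..<b}" for t
  proof -
    obtain w where w: "(g has_vector_derivative w) (at t)" "norm w \<le> W" using gW[of t] t by auto
    have "(v has_vector_derivative w) (at t)"
      using t by (intro has_vector_derivative_transform_within_open[OF w(1), of "{c<..}"])
        (auto simp: v_def)
    then show ?thesis using w by blast
  qed
  interpret curve: piecewise_C2_curve a b x v "insert c S" "max K W"
  proof
    show "(x has_vector_derivative v t) (at t within {a..b})" if "t \<in> {a..b}" for t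
      unfolding x_def using integral_has_vector_derivative[OF contv that]
      by (auto intro!: derivative_eq_intros)
    show "\<exists>w. (v has_vector_derivative w) (at t) \<and> norm w \<le> max K W"
      if "t \<in> {a<..<b} - insert c S" for t
      using dv1[of t] dv2[of t] that by (cases "t < c") (auto simp: le_max_iff_disj)
  qed (use \<open>a < b\<close> fin contv K in auto)

  have jet: "autonomous L (jet a b x t) = L (x t, v t, w)"
    if "t \<in> {a<..<b}" "(v has_vector_derivative w) (at t)" for t w
    using that curve.D1_curve[of t] curve.D2_curve[OF that] by (simp add: autonomous_def jet_def)
  have neg: "autonomous L (jet a b x t) \<le> - N" if "t \<in> {a<..<c} - S" for t
    using dv1[OF that] jet[of t] that c by auto
  have pos: "autonomous L (jet a b x t) \<le> C" if "t \<in> {c<..<b}" for t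
    using dv2[OF that] jet[of t] C(2)[OF xR vV] that c by fastforce
  have "finite (insert a (insert b (insert c S)))" using fin by simp
  from AE_lebesgue_on_notin_finite[OF this, of a b] AE_space[of "lebesgue_on {a..b}"]
  have ae: "AE t in lebesgue_on {a..b}. t \<in> {a<..<b} - insert c S"
    by eventually_elim auto
  have "action a b (autonomous L) x \<le> ereal (C * (b - a) - N * (c - a))"
  proof (rule action_le)
    \<comment> \<open>The bound \<open>C\<close> for the connecting arc also covers the steep arc,
      where the integrand is at most \<open>- N \<le> 0 \<le> C\<close>.\<close>
    show "AE t in lebesgue_on {a..b}. autonomous L (jet a b x t) \<le> C"
      using ae
    proof eventually_elim
      case (elim t)
      then show ?case using neg[of t] pos[of t] \<open>0 \<le> N\<close> \<open>0 \<le> C\<close> by (cases "t < c") auto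
    qed
    show "AE t in lebesgue_on {a..b}. t < c \<longrightarrow> autonomous L (jet a b x t) \<le> - N"
      using ae by eventually_elim (use neg in auto)
  qed (use c C \<open>0 \<le> N\<close> in auto)
  also have "C * (b - a) - N * (c - a) \<le> r"
  proof -
    \<comment> \<open>Because \<open>K * (c - a) = 1\<close>, the first term equals
      \<open>\<alpha> / 2 * K\<close>, which is at least \<open>B\<close>. Subtracting at most
      \<open>C0 + 1\<close> leaves a gain of at least
      \<open>C * (b - a) + \<bar>r\<bar>\<close>.\<close>
    have "N * (c - a) = \<alpha> / 2 * K * (K * (c - a)) - (C0 + 1) * (c - a)"
      by (simp add: N_def power2_eq_square algebra_simps)
    moreover have "c - a \<le> 1" using K by (simp add: c_def)
    then have "(C0 + 1) * (c - a) \<le> (C0 + 1) * 1" using C0 by (intro mult_left_mono) auto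
    ultimately show ?thesis using KB c(4) by (simp add: B_def)
  qed
  finally have "action a b (autonomous L) x \<le> ereal r" by simp
  moreover have "x \<in> boundary_conditions a b xa0 xb0 xa1 xb1"
    using xb curve.D1_curve[of a] curve.D1_curve[of b] \<open>a < b\<close> c v1a g(2)
    by (simp add: boundary_conditions_def v_def) (simp add: x_def)
  ultimately show ?thesis using curve.W2inf_curve by blast
qed

section \<open>Equality of the two infima\<close>

theorem corollary1:
  fixes a b :: real
    and L :: "(real ^ 'n::finite) \<times> (real ^ 'n) \<times> (real ^ 'n) \<Rightarrow> real"
    and xa0 xb0 xa1 xb1 :: "real ^ 'n"
  assumes "a < b"
    and "C1_function L"
    and "\<forall>x \<in> W22 a b \<inter> boundary_conditions a b xa0 xb0 xa1 xb1.
           hyp_S0 a b (autonomous L) x"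
    and "\<forall>i. \<forall>x \<in> W22 a b \<inter> boundary_conditions a b xa0 xb0 xa1 xb1.
           hyp_S a b (autonomous L) i x"
    and "\<exists>\<alpha>>0. \<exists>\<beta>>0. \<forall>s v w.
           \<alpha> * norm w + \<beta> \<le> norm (gradient (\<lambda>y. L (s, v, y)) w)"
  shows "(INF x \<in> W22 a b \<inter> boundary_conditions a b xa0 xb0 xa1 xb1. action a b (autonomous L) x)
       = (INF x \<in> W2inf a b \<inter> boundary_conditions a b xa0 xb0 xa1 xb1. action a b (autonomous L) x)"
proof -
  let ?BC = "boundary_conditions a b xa0 xb0 xa1 xb1"
  have "(INF x \<in> W2inf a b \<inter> ?BC. action a b (autonomous L) x) \<le> ereal r" for r
    using action_unbounded_below[OF assms(1,2), of _ _ xa0 xb0 xa1 xb1 r] assms(5)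
    by (meson INF_lower2)
  then have inf: "(INF x \<in> W2inf a b \<inter> ?BC. action a b (autonomous L) x) = - \<infinity>"
    by (rule ereal_bot)
  \<comment> \<open>The larger class has the smaller infimum, so it is also
    \<open>- \<infinity>\<close>.\<close>
  moreover have "(INF x \<in> W22 a b \<inter> ?BC. action a b (autonomous L) x)
      \<le> (INF x \<in> W2inf a b \<inter> ?BC. action a b (autonomous L) x)"
    by (rule INF_superset_mono) (auto simp: W2inf_def)
  ultimately show ?thesis by simp
qed

end
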